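(* Let $R=\mathbb F_{q_1}\times\cdots\times\mathbb F_{q_t}$ be a product of $t\ge 3$ finite fields of arbitrary orders $q_1,\dots,q_t$, and let $k^\ast=\operatorname{argmin}_i q_i$ (any index at which $q_i$ is minimal). Then $$\alpha(\mathcal D(R))=\max\Bigl(t,\ 1+\prod_{i\ne k^\ast}(q_i-1)\Bigr).$$
   Context: The product over $i\ne k^\ast$ runs over $i\in\{1,\dots,t\}\setminus\{k^\ast\}$. $Z(R)$ is the set of zero-divisors of $R$ and $Z(R)^*=Z(R)\setminus\{0\}$. $\Gamma(R)$ is the simple graph with vertex set $Z(R)^*$, with distinct $x,y$ adjacent iff $xy=0$. $W\Gamma(R)$ is the simple graph with vertex set $Z(R)^*$, with distinct $x,y$ adjacent iff there exist nonzero $r\in\operatorname{Ann}(x)$ and nonzero $s\in\operatorname{Ann}(y)$ with $rs=0$. The weak zero-divisor difference graph $\mathcal D(R)$ is the graph on $Z(R)^*$ with edge set $E(W\Gamma(R))\setminus E(\Gamma(R))$, with resulting isolated vertices deleted (for $t\ge3$ no vertex is in fact isolated, so the vertex set is $Z(R)^*$). $\alpha(G)$ is the independence number, the maximum size of an independent set of $G$. *)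

theory Defs
  imports "HOL-Algebra.Chinese_Remainder" "HOL-Library.Ramsey"
begin

text \<open>Edges are unordered pairs, so that \<open>indep\<close> from Ramsey's theorem applies directly.\<close>

record 'v sgraph =
  verts :: "'v set"
  edges :: "'v set set"

text \<open>
  Meaningful only for finite vertex sets: \<open>Max\<close> is unspecified on infinite sets.
\<close>

definition independence_number :: "'v sgraph \<Rightarrow> nat"
  where "independence_number G = Max {card S | S. S \<subseteq> verts G \<and> indep S (edges G)}"

definition delete_isolated :: "'v sgraph \<Rightarrow> 'v sgraph"
  where "delete_isolated G =
    \<lparr>verts = {v \<in> verts G. \<exists>e\<in>edges G. v \<in> e}, edges = edges G\<rparr>"

text \<open>
  The following notions are meant for commutative rings, where left and right annihilators
  agree. Zero itself counts as a zero-divisor (of a nonzero ring).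
\<close>

definition zero_divisors :: "('a, 'b) ring_scheme \<Rightarrow> 'a set"
  where "zero_divisors R =
    {x \<in> carrier R. \<exists>y \<in> carrier R - {\<zero>\<^bsub>R\<^esub>}. x \<otimes>\<^bsub>R\<^esub> y = \<zero>\<^bsub>R\<^esub>}"

definition annihilator :: "('a, 'b) ring_scheme \<Rightarrow> 'a \<Rightarrow> 'a set"
  where "annihilator R x = {r \<in> carrier R. r \<otimes>\<^bsub>R\<^esub> x = \<zero>\<^bsub>R\<^esub>}"

definition zero_divisor_graph :: "('a, 'b) ring_scheme \<Rightarrow> 'a sgraph"
  where "zero_divisor_graph R =
    \<lparr>verts = zero_divisors R - {\<zero>\<^bsub>R\<^esub>},
     edges = {{x, y} | x y. x \<in> zero_divisors R - {\<zero>\<^bsub>R\<^esub>} \<and> y \<in> zero_divisors R - {\<zero>\<^bsub>R\<^esub>} \<and>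
                x \<noteq> y \<and> x \<otimes>\<^bsub>R\<^esub> y = \<zero>\<^bsub>R\<^esub>}\<rparr>"

definition weak_zero_divisor_graph :: "('a, 'b) ring_scheme \<Rightarrow> 'a sgraph"
  where "weak_zero_divisor_graph R =
    \<lparr>verts = zero_divisors R - {\<zero>\<^bsub>R\<^esub>},
     edges = {{x, y} | x y. x \<in> zero_divisors R - {\<zero>\<^bsub>R\<^esub>} \<and> y \<in> zero_divisors R - {\<zero>\<^bsub>R\<^esub>} \<and>
                x \<noteq> y \<and>
                (\<exists>r \<in> annihilator R x - {\<zero>\<^bsub>R\<^esub>}. \<exists>s \<in> annihilator R y - {\<zero>\<^bsub>R\<^esub>}.
                   r \<otimes>\<^bsub>R\<^esub> s = \<zero>\<^bsub>R\<^esub>)}\<rparr>"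

definition weak_zero_divisor_difference_graph :: "('a, 'b) ring_scheme \<Rightarrow> 'a sgraph"
  where "weak_zero_divisor_difference_graph R = delete_isolated
    \<lparr>verts = zero_divisors R - {\<zero>\<^bsub>R\<^esub>},
     edges = edges (weak_zero_divisor_graph R) - edges (zero_divisor_graph R)\<rparr>"

end

theory Submission
  imports Defs
begin

text \<open>
  All the relevant data of an element is its support, the set of indices of its nonzero
  coordinates: vertices are the elements whose support is nonempty and proper, and distinct
  vertices are nonadjacent iff their supports are disjoint or both equal the complement of the
  same singleton. As there are at least three factors, two complements of singletons
  always meet. So an independent set either has pairwise disjoint supports, hence at most as many
  elements as there are factors, or it consists of elements whose support is the complement of
  one index \<open>i\<close>, plus at most one element with support \<open>{i}\<close>.
\<close>

text \<open>A pair \<open>{x, y}\<close> determines its two elements only up to order, so membership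
  in a set of unordered pairs reduces to the defining relation once that relation is
  symmetric.\<close>

lemma ex_doubleton_eq_iff:
  assumes "\<And>x y. Q x y \<Longrightarrow> Q y x"
  shows "(\<exists>x' y'. {x, y} = {x', y'} \<and> Q x' y') \<longleftrightarrow> Q x y"
  using assms by (auto simp: doubleton_eq_iff)

section \<open>Coordinates of zero and of products in a list of rings\<close>

lemma RDirProd_list_zero_nth:
  assumes "i < length Rs"
  shows "\<zero>\<^bsub>RDirProd_list Rs\<^esub> ! i = \<zero>\<^bsub>Rs ! i\<^esub>"
  using assms
proof (induction Rs arbitrary: i)
  case (Cons R Rs)
  then show ?case by (cases i) (auto simp: RDirProd_list_zero')
qed simp

lemma RDirProd_list_mult_nth:
  assumes "x \<in> carrier (RDirProd_list Rs)" "y \<in> carrier (RDirProd_list Rs)" "i < length Rs"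
  shows "(x \<otimes>\<^bsub>RDirProd_list Rs\<^esub> y) ! i = x ! i \<otimes>\<^bsub>Rs ! i\<^esub> y ! i"
  using assms
proof (induction Rs arbitrary: x y i)
  case (Cons R Rs)
  from Cons.prems obtain a as b bs where xy: "x = a # as" "y = b # bs"
    and "a \<in> carrier R" "b \<in> carrier R"
    and as: "as \<in> carrier (RDirProd_list Rs)" "bs \<in> carrier (RDirProd_list Rs)"
    by (auto simp: RDirProd_list_carrier)
  then have mem: "(a, as) \<in> carrier (RDirProd R (RDirProd_list Rs))"
      "(b, bs) \<in> carrier (RDirProd R (RDirProd_list Rs))"
    by (auto simp: RDirProd_carrier)
  \<comment> \<open>Multiplication is carried over from the binary product
    \<open>RDirProd R (RDirProd_list Rs)\<close>, where it is componentwise, along the homomorphism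
    sending a pair to head and tail.\<close>
  have "x \<otimes>\<^bsub>RDirProd_list (R # Rs)\<^esub> y = (a \<otimes>\<^bsub>R\<^esub> b) # (as \<otimes>\<^bsub>RDirProd_list Rs\<^esub> bs)"
    using ring_hom_mult[OF RDirProd_list_hom1 mem]
    by (simp add: xy RDirProd_def DirProd_def monoid.defs)
  then show ?case
    using Cons.IH[OF as] Cons.prems(3) by (cases i) (auto simp: xy)
qed simp

section \<open>Supports of elements in a product of fields\<close>

locale field_list =
  fixes Rs :: "('a, 'b) ring_scheme list"
  assumes field_nth: "i < length Rs \<Longrightarrow> field (Rs ! i)"
begin

abbreviation n :: nat where "n \<equiv> length Rs"

abbreviation P :: "'a list ring" where "P \<equiv> RDirProd_list Rs"

text \<open>The bound \<open>i < n\<close> keeps positions past the end, where \<open>!\<close> is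
  unspecified, out of the support.\<close>

definition supp :: "'a list \<Rightarrow> nat set"
  where "supp x = {i. i < n \<and> x ! i \<noteq> \<zero>\<^bsub>Rs ! i\<^esub>}"

lemma ring_nth: "i < n \<Longrightarrow> ring (Rs ! i)"
  using field_nth by (simp add: cring.axioms(1) fieldE(1))

lemma ring_P: "ring P"
  by (intro RDirProd_list_is_ring ring_nth)

lemma supp_subset: "supp x \<subseteq> {..<n}"
  by (auto simp: supp_def)

lemma supp_eq_empty_iff:
  assumes "x \<in> carrier P"
  shows "supp x = {} \<longleftrightarrow> x = \<zero>\<^bsub>P\<^esub>"
proof
  have z: "\<zero>\<^bsub>P\<^esub> \<in> carrier P"
    using ring.ring_simprules(2)[OF ring_P] .
  assume "supp x = {}"
  then show "x = \<zero>\<^bsub>P\<^esub>"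
    using RDirProd_list_carrier_mem(1)[OF assms] RDirProd_list_carrier_mem(1)[OF z]
    by (intro nth_equalityI) (auto simp: supp_def RDirProd_list_zero_nth)
qed (auto simp: supp_def RDirProd_list_zero_nth)

text \<open>Each factor is an integral domain, so a coordinate of a product vanishes only if a
  coordinate of one of the two elements does. This turns ring equations into statements about index
  sets.\<close>

lemma supp_mult:
  assumes "x \<in> carrier P" "y \<in> carrier P"
  shows "supp (x \<otimes>\<^bsub>P\<^esub> y) = supp x \<inter> supp y"
proof -
  have "x ! i \<otimes>\<^bsub>Rs ! i\<^esub> y ! i = \<zero>\<^bsub>Rs ! i\<^esub> \<longleftrightarrow> x ! i = \<zero>\<^bsub>Rs ! i\<^esub> \<or> y ! i = \<zero>\<^bsub>Rs ! i\<^esub>"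
    if "i < n" for i
    using domain.integral_iff[OF field.axioms(1)[OF field_nth[OF that]]] that
      RDirProd_list_carrier_mem(2)[OF assms(1)] RDirProd_list_carrier_mem(2)[OF assms(2)] by blast
  then have "i \<in> supp (x \<otimes>\<^bsub>P\<^esub> y) \<longleftrightarrow> i \<in> supp x \<inter> supp y" for i
    by (cases "i < n") (simp_all add: supp_def RDirProd_list_mult_nth[OF assms])
  then show ?thesis
    by blast
qed

lemma mult_eq_zero_iff:
  assumes "x \<in> carrier P" "y \<in> carrier P"
  shows "x \<otimes>\<^bsub>P\<^esub> y = \<zero>\<^bsub>P\<^esub> \<longleftrightarrow> supp x \<inter> supp y = {}"
  using supp_mult[OF assms] supp_eq_empty_iff[OF ring.ring_simprules(5)[OF ring_P assms]] by simp

lemma supp_surj: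
  assumes "S \<subseteq> {..<n}"
  obtains x where "x \<in> carrier P" "supp x = S"
proof
  \<comment> \<open>The idempotent of \<open>S\<close>; its support is all of \<open>S\<close>
    because one differs from zero in a field.\<close>
  let ?x = "map (\<lambda>i. if i \<in> S then \<one>\<^bsub>Rs ! i\<^esub> else \<zero>\<^bsub>Rs ! i\<^esub>) [0..<n]"
  show "?x \<in> carrier P"
    using ring_nth by (intro RDirProd_list_carrier_memI) (auto simp: ring.ring_simprules)
  show "supp ?x = S"
    using assms field_nth
    by (auto simp: supp_def domain.one_not_zero field.axioms(1) split: if_splits)
qed

text \<open>An element with support \<open>S\<close> amounts to a free choice of a nonzero
  coordinate at each index of \<open>S\<close>, the other coordinates being forced to be
  zero.\<close>

lemma card_supp_eq:
  assumes "S \<subseteq> {..<n}"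
  shows "card {x \<in> carrier P. supp x = S} = (\<Prod>i\<in>S. order (Rs ! i) - 1)"
proof -
  let ?B = "\<lambda>i. if i \<in> S then carrier (Rs ! i) - {\<zero>\<^bsub>Rs ! i\<^esub>} else {\<zero>\<^bsub>Rs ! i\<^esub>}"
  have "bij_betw (\<lambda>f. map f [0..<n]) (PiE {..<n} ?B) {x \<in> carrier P. supp x = S}"
  proof (rule bij_betw_byWitness[where f' = "\<lambda>x. restrict ((!) x) {..<n}"])
    show "\<forall>f\<in>PiE {..<n} ?B. restrict ((!) (map f [0..<n])) {..<n} = f"
      by (simp add: fun_eq_iff PiE_def extensional_def)
    show "\<forall>x\<in>{x \<in> carrier P. supp x = S}. map (restrict ((!) x) {..<n}) [0..<n] = x"
      by (auto intro!: nth_equalityI dest: RDirProd_list_carrier_mem(1))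
    show "(\<lambda>f. map f [0..<n]) ` PiE {..<n} ?B \<subseteq> {x \<in> carrier P. supp x = S}"
    proof (intro image_subsetI CollectI conjI equalityI subsetI)
      fix f assume f: "f \<in> PiE {..<n} ?B"
      then have fB: "f i \<in> ?B i" if "i < n" for i
        using PiE_mem[OF f] that by simp
      show "map f [0..<n] \<in> carrier P"
      proof (rule RDirProd_list_carrier_memI)
        fix i assume "i < n"
        then show "map f [0..<n] ! i \<in> carrier (Rs ! i)"
          using fB[of i] ring.ring_simprules(2)[OF ring_nth] by (auto split: if_splits)
      qed simp
      fix i
      show "i \<in> S" if "i \<in> supp (map f [0..<n])"
        using that fB by (fastforce simp: supp_def split: if_splits)
      show "i \<in> supp (map f [0..<n])" if "i \<in> S"
        using that fB[of i] assms by (auto simp: supp_def)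
    qed
    show "(\<lambda>x. restrict ((!) x) {..<n}) ` {x \<in> carrier P. supp x = S} \<subseteq> PiE {..<n} ?B"
      by (auto simp: supp_def RDirProd_list_carrier_mem(2))
  qed
  then have "card {x \<in> carrier P. supp x = S} = card (PiE {..<n} ?B)"
    by (simp add: bij_betw_same_card)
  also have "\<dots> = (\<Prod>i<n. card (?B i))"
    by (simp add: card_PiE)
  also have "\<dots> = (\<Prod>i\<in>S. card (?B i))"
    using assms by (intro prod.mono_neutral_right) auto
  \<comment> \<open>If a carrier is infinite, \<open>card\<close> and truncated subtraction make
    both factors 0, so they agree in that case too.\<close>
  also have "\<dots> = (\<Prod>i\<in>S. order (Rs ! i) - 1)"
    using assms ring_nth by (intro prod.cong)
      (auto simp: order_def card_Diff_singleton ring.ring_simprules subset_eq)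
  finally show ?thesis .
qed

section \<open>Zero-divisors, annihilators and edges in terms of supports\<close>

lemma zero_divisors_P:
  "zero_divisors P = {x \<in> carrier P. supp x \<noteq> {..<n}}"
proof (intro equalityI subsetI)
  fix x assume "x \<in> zero_divisors P"
  then obtain y where y: "x \<in> carrier P" "y \<in> carrier P" "y \<noteq> \<zero>\<^bsub>P\<^esub>" "x \<otimes>\<^bsub>P\<^esub> y = \<zero>\<^bsub>P\<^esub>"
    by (auto simp: zero_divisors_def)
  then have "supp x \<inter> supp y = {}" "supp y \<noteq> {}"
    by (simp_all add: supp_eq_empty_iff mult_eq_zero_iff)
  with y(1) show "x \<in> {x \<in> carrier P. supp x \<noteq> {..<n}}"
    using supp_subset[of y] by blast
next
  fix x assume "x \<in> {x \<in> carrier P. supp x \<noteq> {..<n}}"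
  then have x: "x \<in> carrier P" "supp x \<noteq> {..<n}" by auto
  \<comment> \<open>An element living on the complement of \<open>supp x\<close> annihilates
    \<open>x\<close>, and it is nonzero since that complement is nonempty.\<close>
  obtain y where y: "y \<in> carrier P" "supp y = {..<n} - supp x"
    using supp_surj[of "{..<n} - supp x"] by blast
  then have "y \<noteq> \<zero>\<^bsub>P\<^esub>"
    using x supp_subset[of x] supp_eq_empty_iff[OF y(1)] by blast
  with x y show "x \<in> zero_divisors P"
    by (auto simp: zero_divisors_def mult_eq_zero_iff)
qed

lemma annihilator_P:
  assumes "x \<in> carrier P"
  shows "annihilator P x = {r \<in> carrier P. supp r \<inter> supp x = {}}"
  using assms by (auto simp: annihilator_def mult_eq_zero_iff)

text \<open>Nonzero annihilating elements have nonempty supports inside the complements of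
  \<open>supp x\<close> and \<open>supp y\<close>, and their product vanishes iff these supports are
  disjoint. Two nonempty sets contain disjoint nonempty subsets unless both are the same
  singleton.\<close>

lemma weak_adjacent_iff:
  assumes "x \<in> carrier P" "supp x \<noteq> {..<n}" "y \<in> carrier P" "supp y \<noteq> {..<n}"
  shows "(\<exists>r \<in> annihilator P x - {\<zero>\<^bsub>P\<^esub>}. \<exists>s \<in> annihilator P y - {\<zero>\<^bsub>P\<^esub>}. r \<otimes>\<^bsub>P\<^esub> s = \<zero>\<^bsub>P\<^esub>)
    \<longleftrightarrow> \<not> (\<exists>i<n. supp x = {..<n} - {i} \<and> supp y = {..<n} - {i})"
proof
  assume "\<exists>r \<in> annihilator P x - {\<zero>\<^bsub>P\<^esub>}. \<exists>s \<in> annihilator P y - {\<zero>\<^bsub>P\<^esub>}. r \<otimes>\<^bsub>P\<^esub> s = \<zero>\<^bsub>P\<^esub>"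
  then obtain r s where "r \<in> carrier P" "s \<in> carrier P" "r \<noteq> \<zero>\<^bsub>P\<^esub>" "s \<noteq> \<zero>\<^bsub>P\<^esub>"
    "r \<otimes>\<^bsub>P\<^esub> s = \<zero>\<^bsub>P\<^esub>" and disj: "supp r \<inter> supp x = {}" "supp s \<inter> supp y = {}"
    unfolding annihilator_P[OF assms(1)] annihilator_P[OF assms(3)] by blast
  then have "supp r \<noteq> {}" "supp s \<noteq> {}" "supp r \<inter> supp s = {}"
    by (simp_all add: supp_eq_empty_iff mult_eq_zero_iff)
  moreover have "supp r = {i}" "supp s = {i}" if "supp x = {..<n} - {i}" "supp y = {..<n} - {i}" for i
    using calculation disj supp_subset[of r] supp_subset[of s] unfolding that by blast+
  ultimately show "\<not> (\<exists>i<n. supp x = {..<n} - {i} \<and> supp y = {..<n} - {i})"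
    by (metis Int_absorb insert_not_empty)
next
  assume *: "\<not> (\<exists>i<n. supp x = {..<n} - {i} \<and> supp y = {..<n} - {i})"
  \<comment> \<open>Two distinct indices, one outside each support, suffice: elements supported on
    \<open>{i}\<close> and \<open>{j}\<close> then serve as \<open>r\<close> and
    \<open>s\<close>.\<close>
  obtain i j where ij: "i < n" "i \<notin> supp x" "j < n" "j \<notin> supp y" "i \<noteq> j"
  proof -
    obtain i j where ij: "i < n" "i \<notin> supp x" "j < n" "j \<notin> supp y"
      using assms supp_subset[of x] supp_subset[of y] by blast
    \<comment> \<open>If the same index was picked twice, some other index is missing from one of
      the supports and can replace it on that side.\<close>
    have "\<exists>l<n. l \<noteq> i \<and> (l \<notin> supp x \<or> l \<notin> supp y)" if "i = j"
    proof (rule ccontr)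
      assume "\<not> ?thesis"
      then have "supp x = {..<n} - {i}" "supp y = {..<n} - {i}"
        using that ij supp_subset[of x] supp_subset[of y] by auto
      with * ij show False by blast
    qed
    with that ij show ?thesis by metis
  qed
  obtain r where r: "r \<in> carrier P" "supp r = {i}"
    using supp_surj[of "{i}"] ij by auto
  then have "r \<in> annihilator P x - {\<zero>\<^bsub>P\<^esub>}"
    using supp_eq_empty_iff[OF r(1)] ij by (simp add: annihilator_P[OF assms(1)])
  moreover obtain s where s: "s \<in> carrier P" "supp s = {j}"
    using supp_surj[of "{j}"] ij by auto
  then have "s \<in> annihilator P y - {\<zero>\<^bsub>P\<^esub>}"
    using supp_eq_empty_iff[OF s(1)] ij by (simp add: annihilator_P[OF assms(3)])
  moreover have "r \<otimes>\<^bsub>P\<^esub> s = \<zero>\<^bsub>P\<^esub>"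
    using r s ij by (simp add: mult_eq_zero_iff)
  ultimately show "\<exists>r \<in> annihilator P x - {\<zero>\<^bsub>P\<^esub>}. \<exists>s \<in> annihilator P y - {\<zero>\<^bsub>P\<^esub>}. r \<otimes>\<^bsub>P\<^esub> s = \<zero>\<^bsub>P\<^esub>"
    by blast
qed

text \<open>The common vertex set before isolated vertices are deleted, phrased by supports so that
  the edge relations need no further mention of the ring.\<close>

definition V :: "'a list set"
  where "V = {x \<in> carrier P. supp x \<noteq> {} \<and> supp x \<noteq> {..<n}}"

lemma V_eq: "V = zero_divisors P - {\<zero>\<^bsub>P\<^esub>}"
  unfolding V_def zero_divisors_P using supp_eq_empty_iff by blast

lemma weak_edge_iff:
  "{x, y} \<in> edges (weak_zero_divisor_graph P) \<longleftrightarrow> x \<in> V \<and> y \<in> V \<and> x \<noteq> y \<and>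
    \<not> (\<exists>i<n. supp x = {..<n} - {i} \<and> supp y = {..<n} - {i})"
proof -
  have "{x, y} \<in> edges (weak_zero_divisor_graph P) \<longleftrightarrow> (\<exists>x' y'. {x, y} = {x', y'} \<and>
      x' \<in> V \<and> y' \<in> V \<and> x' \<noteq> y' \<and>
      \<not> (\<exists>i<n. supp x' = {..<n} - {i} \<and> supp y' = {..<n} - {i}))"
    unfolding weak_zero_divisor_graph_def V_eq[symmetric] sgraph.simps mem_Collect_eq
    by (intro ex_cong1 conj_cong refl weak_adjacent_iff) (simp_all add: V_def)
  also have "\<dots> \<longleftrightarrow> x \<in> V \<and> y \<in> V \<and> x \<noteq> y \<and>
    \<not> (\<exists>i<n. supp x = {..<n} - {i} \<and> supp y = {..<n} - {i})"
    by (intro ex_doubleton_eq_iff) metis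
  finally show ?thesis .
qed

lemma zero_divisor_edge_iff:
  "{x, y} \<in> edges (zero_divisor_graph P) \<longleftrightarrow>
    x \<in> V \<and> y \<in> V \<and> x \<noteq> y \<and> supp x \<inter> supp y = {}"
proof -
  have "{x, y} \<in> edges (zero_divisor_graph P) \<longleftrightarrow> (\<exists>x' y'. {x, y} = {x', y'} \<and>
      x' \<in> V \<and> y' \<in> V \<and> x' \<noteq> y' \<and> supp x' \<inter> supp y' = {})"
    unfolding zero_divisor_graph_def V_eq[symmetric] sgraph.simps mem_Collect_eq
    by (intro ex_cong1 conj_cong refl mult_eq_zero_iff) (simp_all add: V_def)
  also have "\<dots> \<longleftrightarrow> x \<in> V \<and> y \<in> V \<and> x \<noteq> y \<and> supp x \<inter> supp y = {}"
    by (intro ex_doubleton_eq_iff) (metis Int_commute)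
  finally show ?thesis .
qed

lemma difference_edge_iff:
  "{x, y} \<in> edges (weak_zero_divisor_difference_graph P) \<longleftrightarrow>
    x \<in> V \<and> y \<in> V \<and> x \<noteq> y \<and> supp x \<inter> supp y \<noteq> {} \<and>
    \<not> (\<exists>i<n. supp x = {..<n} - {i} \<and> supp y = {..<n} - {i})"
proof -
  \<comment> \<open>Deleting isolated vertices leaves the edge set unchanged.\<close>
  have "{x, y} \<in> edges (weak_zero_divisor_difference_graph P) \<longleftrightarrow>
      {x, y} \<in> edges (weak_zero_divisor_graph P) \<and> {x, y} \<notin> edges (zero_divisor_graph P)"
    by (simp add: weak_zero_divisor_difference_graph_def delete_isolated_def)
  then show ?thesis
    unfolding weak_edge_iff zero_divisor_edge_iff by argo
qed

end

section \<open>At least three factors: vertices and independent sets\<close>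

locale field_list3 = field_list +
  assumes n_ge_3: "length Rs \<ge> 3"
begin

text \<open>The two sets together miss at most the indices \<open>i\<close> and \<open>j\<close>,
  and there are at least three. The instance \<open>i = j\<close> also yields an index different
  from \<open>i\<close>.\<close>

lemma coatoms_meet: "({..<n} - {i}) \<inter> ({..<n} - {j}) \<noteq> {}"
proof
  assume "({..<n} - {i}) \<inter> ({..<n} - {j}) = {}"
  then have "card {..<n} \<le> card {i, j}"
    by (intro card_mono) auto
  also have "\<dots> \<le> 2"
    by (simp add: card_insert_if)
  finally show False
    using n_ge_3 by simp
qed

text \<open>\<open>{i}\<close> is disjoint from \<open>{..<n} - {i}\<close>, whereas every coatom
  meets it. Hence the coatom exception to adjacency never concerns an element with singleton
  support.\<close>

lemma singleton_not_coatom: "{i} \<noteq> {..<n} - {j}"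
  using coatoms_meet[of i j] by blast

lemma verts_difference: "verts (weak_zero_divisor_difference_graph P) = V"
proof -
  have "\<exists>y. {x, y} \<in> edges (weak_zero_divisor_difference_graph P)" if x: "x \<in> V" for x
  proof (cases "\<exists>i. supp x = {i}")
    case True
    then obtain i where i: "supp x = {i}" by blast
    then have "i < n" using supp_subset[of x] by auto
    \<comment> \<open>A neighbour of an element supported on \<open>{i}\<close> is one supported on
      \<open>{i, j}\<close>, a proper subset as there is a third index.\<close>
    obtain j where j: "j < n" "j \<noteq> i"
      using coatoms_meet[of i i] by auto
    have "{i, j} \<noteq> {..<n}"
      using coatoms_meet[of i j] by auto
    moreover obtain y where "y \<in> carrier P" "supp y = {i, j}"
      using supp_surj[of "{i, j}"] \<open>i < n\<close> j by auto
    moreover have "{i, j} \<noteq> {i}"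
      using j by auto
    ultimately show ?thesis
      using x i by (intro exI[of _ y], subst difference_edge_iff)
        (auto simp: V_def singleton_not_coatom)
  next
    case False
    obtain i where i: "i \<in> supp x" using x by (auto simp: V_def)
    then have "i < n" using supp_subset[of x] by auto
    \<comment> \<open>Here \<open>supp x\<close> is not a singleton, so this \<open>y\<close>
      differs from \<open>x\<close>, meets its support and is no coatom.\<close>
    obtain y where y: "y \<in> carrier P" "supp y = {i}"
      using supp_surj[of "{i}"] \<open>i < n\<close> by auto
    have "{i} \<noteq> {..<n}"
      using coatoms_meet[of i i] by blast
    then show ?thesis
      using x i y False by (intro exI[of _ y], subst difference_edge_iff)
        (auto simp: V_def singleton_not_coatom)
  qed
  then have "\<exists>e\<in>edges (weak_zero_divisor_difference_graph P). x \<in> e" if "x \<in> V" for x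
    using that by (meson insertI1)
  moreover have "verts (weak_zero_divisor_difference_graph P) =
      {x \<in> V. \<exists>e\<in>edges (weak_zero_divisor_difference_graph P). x \<in> e}"
    by (simp only: weak_zero_divisor_difference_graph_def delete_isolated_def sgraph.simps V_eq)
  ultimately show ?thesis
    by auto
qed

lemma indep_iff:
  assumes "A \<subseteq> V"
  shows "indep A (edges (weak_zero_divisor_difference_graph P)) \<longleftrightarrow>
    (\<forall>x\<in>A. \<forall>y\<in>A. x \<noteq> y \<longrightarrow> supp x \<inter> supp y = {} \<or>
      (\<exists>i<n. supp x = {..<n} - {i} \<and> supp y = {..<n} - {i}))"
  unfolding indep_def
proof (intro ball_cong refl)
  fix x y assume "x \<in> A" "y \<in> A"
  then have "x \<in> V" "y \<in> V"
    using assms by auto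
  moreover define W where "W \<longleftrightarrow> (\<exists>i<n. supp x = {..<n} - {i} \<and> supp y = {..<n} - {i})"
  ultimately show "(x \<noteq> y \<longrightarrow> {x, y} \<notin> edges (weak_zero_divisor_difference_graph P)) \<longleftrightarrow>
    (x \<noteq> y \<longrightarrow> supp x \<inter> supp y = {} \<or>
      (\<exists>i<n. supp x = {..<n} - {i} \<and> supp y = {..<n} - {i}))"
    unfolding difference_edge_iff W_def[symmetric] by blast
qed

lemma indepD:
  assumes "A \<subseteq> V" "indep A (edges (weak_zero_divisor_difference_graph P))"
    and "x \<in> A" "y \<in> A" "x \<noteq> y"
  shows "supp x \<inter> supp y = {} \<or> (\<exists>i<n. supp x = {..<n} - {i} \<and> supp y = {..<n} - {i})"
  using assms(2)[unfolded indep_iff[OF assms(1)], rule_format, OF assms(3-5)] .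

section \<open>The upper bound on independent sets\<close>

lemma card_coatom:
  "card {x \<in> carrier P. supp x = {..<n} - {i}} = (\<Prod>j\<in>{..<n} - {i}. order (Rs ! j) - 1)"
  by (simp add: card_supp_eq)

lemma order_ge_2:
  assumes "i < n" "finite (carrier (Rs ! i))"
  shows "order (Rs ! i) \<ge> 2"
proof -
  have "domain (Rs ! i)"
    using field_nth[OF assms(1)] by (rule field.axioms(1))
  then have neq: "\<zero>\<^bsub>Rs ! i\<^esub> \<noteq> \<one>\<^bsub>Rs ! i\<^esub>"
    by (rule domain.zero_not_one)
  have "card {\<zero>\<^bsub>Rs ! i\<^esub>, \<one>\<^bsub>Rs ! i\<^esub>} \<le> card (carrier (Rs ! i))"
    using assms(2) ring.ring_simprules(2,6)[OF ring_nth[OF assms(1)]] by (intro card_mono) simp_all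
  with neq show ?thesis by (simp add: order_def)
qed

lemma card_indep_le:
  assumes fin: "\<And>i. i < n \<Longrightarrow> finite (carrier (Rs ! i))"
    and k: "k < n" "\<And>i. i < n \<Longrightarrow> order (Rs ! k) \<le> order (Rs ! i)"
    and A: "A \<subseteq> V" "indep A (edges (weak_zero_divisor_difference_graph P))"
  shows "card A \<le> max n (1 + (\<Prod>j\<in>{..<n} - {k}. order (Rs ! j) - 1))"
proof (cases "\<exists>x\<in>A. \<exists>i<n. supp x = {..<n} - {i}")
  case False
  then have disj: "supp x \<inter> supp y = {}" if "x \<in> A" "y \<in> A" "x \<noteq> y" for x y
    using that indepD[OF A that] by metis
  have ne: "supp x \<noteq> {}" if "x \<in> A" for x
    using that A(1) by (auto simp: V_def)
  \<comment> \<open>Choosing one index from each of the pairwise disjoint nonempty supports is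
    injective, so \<open>A\<close> has at most \<open>n\<close> elements.\<close>
  define f where "f x = (SOME i. i \<in> supp x)" for x
  have f: "f x \<in> supp x" if "x \<in> A" for x
    unfolding f_def using ne[OF that] by (simp add: some_in_eq)
  have "inj_on f A"
    using f disj by (intro inj_onI) (metis IntI empty_iff)
  moreover have "f ` A \<subseteq> {..<n}"
    using f supp_subset by blast
  ultimately have "card A \<le> card {..<n}"
    by (intro card_inj_on_le[of f]) auto
  then show ?thesis by simp
next
  case True
  then obtain x i where x: "x \<in> A" "i < n" "supp x = {..<n} - {i}" by blast
  let ?C = "{y \<in> carrier P. supp y = {..<n} - {i}}"
  \<comment> \<open>An element nonadjacent to \<open>x\<close> either shares its coatom or has
    nonempty support disjoint from \<open>{..<n} - {i}\<close>, which leaves only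
    \<open>{i}\<close>.\<close>
  have coat: "supp y = {..<n} - {i} \<or> supp y = {i}" if y: "y \<in> A" for y
  proof (rule ccontr)
    assume neg: "\<not> ?thesis"
    with x have "x \<noteq> y" by auto
    then consider "supp x \<inter> supp y = {}" | j where "j < n" "supp x = {..<n} - {j}" "supp y = {..<n} - {j}"
      using indepD[OF A x(1) y] by metis
    then show False
    proof cases
      case 1
      then have "supp y \<subseteq> {i}" "supp y \<noteq> {}"
        using x y A(1) supp_subset[of y] by (auto simp: V_def)
      with neg show False by blast
    next
      case 2
      with x neg show False by metis
    qed
  qed
  \<comment> \<open>Two distinct elements supported on \<open>{i}\<close> would be adjacent: their
    supports meet and are not coatoms.\<close>
  have one: "card {y \<in> A. supp y = {i}} \<le> 1"
  proof -
    have "inj_on supp {y \<in> A. supp y = {i}}"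
    proof (rule inj_onI, rule ccontr)
      fix y z assume yz: "y \<in> {y \<in> A. supp y = {i}}" "z \<in> {y \<in> A. supp y = {i}}" "y \<noteq> z"
      then have "supp y = {i}" "supp z = {i}" by auto
      then show False
        using indepD[OF A, of y z] yz singleton_not_coatom by simp
    qed
    then have "card {y \<in> A. supp y = {i}} \<le> card {{i}}"
      by (rule card_inj_on_le) auto
    then show ?thesis by simp
  qed
  have pos: "order (Rs ! j) - 1 > 0" if "j < n" for j
    using order_ge_2[OF that fin[OF that]] by simp
  \<comment> \<open>Finiteness is read off from positive cardinality, as \<open>card\<close> is 0 on
    infinite sets.\<close>
  have finC: "finite ?C"
  proof (rule card_ge_0_finite)
    show "card ?C > 0"
      unfolding card_coatom using pos by (intro prod_pos) auto
  qed
  have "A = {y \<in> A. supp y = {i}} \<union> {y \<in> A. supp y = {..<n} - {i}}"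
    using coat by blast
  then have "card A = card ({y \<in> A. supp y = {i}} \<union> {y \<in> A. supp y = {..<n} - {i}})"
    by (rule arg_cong)
  also have "\<dots> \<le> card {y \<in> A. supp y = {i}} + card {y \<in> A. supp y = {..<n} - {i}}"
    by (rule card_Un_le)
  also have "\<dots> \<le> 1 + card ?C"
    using one finC A(1) by (intro add_mono card_mono) (auto simp: V_def)
  also have "card ?C \<le> (\<Prod>j\<in>{..<n} - {k}. order (Rs ! j) - 1)"
  proof (cases "i = k")
    case False
    \<comment> \<open>The products omitting \<open>i\<close> and omitting \<open>k\<close> share the
      factor \<open>?p\<close>. They differ only in the factor for \<open>k\<close> against the
      factor for \<open>i\<close>, and minimality of \<open>k\<close> compares these.\<close>
    let ?p = "\<Prod>j\<in>{..<n} - {i} - {k}. order (Rs ! j) - 1"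
    have "(\<Prod>j\<in>{..<n} - {i}. order (Rs ! j) - 1) = (order (Rs ! k) - 1) * ?p"
      using k(1) False by (subst prod.remove[of _ k]) auto
    also have "\<dots> \<le> (order (Rs ! i) - 1) * ?p"
      using k(2)[OF x(2)] by (intro mult_right_mono diff_le_mono) auto
    also have "\<dots> = (\<Prod>j\<in>{..<n} - {k}. order (Rs ! j) - 1)"
      using x(2) False by (subst (2) prod.remove[of _ i]) (auto simp: Diff_insert2[symmetric] insert_commute)
    finally show ?thesis unfolding card_coatom .
  qed (simp only: card_coatom order.refl)
  finally show ?thesis by simp
qed

section \<open>Independent sets attaining both values, and the resulting maximum\<close>

lemma indep_atoms:
  obtains A where "A \<subseteq> V" "indep A (edges (weak_zero_divisor_difference_graph P))" "card A = n"
proof -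
  have "\<forall>i<n. \<exists>x\<in>carrier P. supp x = {i}"
    using supp_surj[of "{i}" for i] by (metis empty_subsetI insert_subset lessThan_iff)
  then obtain e where e: "\<And>i. i < n \<Longrightarrow> e i \<in> carrier P" "\<And>i. i < n \<Longrightarrow> supp (e i) = {i}"
    by metis
  have "inj_on e {..<n}"
    using e(2) by (intro inj_onI) (metis lessThan_iff singleton_inject)
  then have card: "card (e ` {..<n}) = n"
    by (simp add: card_image)
  have "{i} \<noteq> {..<n}" for i
    using coatoms_meet[of i i] by blast
  then have sub: "e ` {..<n} \<subseteq> V"
    using e by (auto simp: V_def)
  show ?thesis
    using e(2) by (intro that[OF sub _ card], subst indep_iff[OF sub]) auto
qed

text \<open>All elements supported on the complement of \<open>k\<close> are mutually nonadjacent,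
  and one element supported on \<open>{k}\<close> can be added because its support is disjoint from
  theirs.\<close>

lemma indep_coatoms:
  assumes "k < n" and "\<And>i. i < n \<Longrightarrow> finite (carrier (Rs ! i))"
  obtains A where "A \<subseteq> V" "indep A (edges (weak_zero_divisor_difference_graph P))"
    "card A = 1 + (\<Prod>j\<in>{..<n} - {k}. order (Rs ! j) - 1)"
proof -
  let ?C = "{x \<in> carrier P. supp x = {..<n} - {k}}"
  obtain x where x: "x \<in> carrier P" "supp x = {k}"
    using supp_surj[of "{k}"] assms(1) by auto
  have "card ?C > 0"
    unfolding card_coatom using order_ge_2 assms(2) by (intro prod_pos) fastforce
  then have "finite ?C"
    by (rule card_ge_0_finite)
  then have card: "card (insert x ?C) = 1 + (\<Prod>j\<in>{..<n} - {k}. order (Rs ! j) - 1)"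
    using x singleton_not_coatom by (subst card_insert_disjoint) (auto simp: card_coatom)
  have "{k} \<noteq> {..<n}" "{..<n} - {k} \<noteq> {}" "{..<n} - {k} \<noteq> {..<n}"
    using coatoms_meet[of k k] assms(1) by blast+
  then have sub: "insert x ?C \<subseteq> V"
    using x by (auto simp: V_def)
  show ?thesis
    using x assms(1) by (intro that[OF sub _ card], subst indep_iff[OF sub]) auto
qed

theorem independence_number_difference:
  assumes fin: "\<And>i. i < n \<Longrightarrow> finite (carrier (Rs ! i))"
    and k: "k < n" "\<And>i. i < n \<Longrightarrow> order (Rs ! k) \<le> order (Rs ! i)"
  shows "independence_number (weak_zero_divisor_difference_graph P)
    = max n (1 + (\<Prod>j\<in>{..<n} - {k}. order (Rs ! j) - 1))"
  unfolding independence_number_def verts_difference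
proof (rule Max_eqI)
  let ?m = "max n (1 + (\<Prod>j\<in>{..<n} - {k}. order (Rs ! j) - 1))"
  let ?M = "{card S |S. S \<subseteq> V \<and> indep S (edges (weak_zero_divisor_difference_graph P))}"
  show le: "m \<le> ?m" if "m \<in> ?M" for m
    using that card_indep_le[OF assms] by blast
  \<comment> \<open>A bounded set of naturals is finite, which gives \<open>Max\<close> its intended
    meaning even before finiteness of \<open>V\<close> is considered.\<close>
  then show "finite ?M"
    by (meson finite_nat_set_iff_bounded_le)
  obtain A where "A \<subseteq> V" "indep A (edges (weak_zero_divisor_difference_graph P))" "card A = n"
    by (rule indep_atoms)
  moreover obtain B where "B \<subseteq> V" "indep B (edges (weak_zero_divisor_difference_graph P))"
    "card B = 1 + (\<Prod>j\<in>{..<n} - {k}. order (Rs ! j) - 1)"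
    using indep_coatoms[OF k(1) fin] by metis
  ultimately show "?m \<in> ?M"
    unfolding max_def mem_Collect_eq by metis
qed

end

theorem theorem7p6:
  fixes F :: "nat \<Rightarrow> ('a, 'b) ring_scheme" and q :: "nat \<Rightarrow> nat" and t k :: nat
  assumes "t \<ge> 3"
    and "\<And>i. i \<in> {1..t} \<Longrightarrow> field (F i)"
    and "\<And>i. i \<in> {1..t} \<Longrightarrow> finite (carrier (F i))"
    and "\<And>i. i \<in> {1..t} \<Longrightarrow> q i = order (F i)"
    and "is_arg_min q (\<lambda>i. i \<in> {1..t}) k"
  shows "independence_number
           (weak_zero_divisor_difference_graph (RDirProd_list (map F [1..<Suc t])))
         = max t (1 + (\<Prod>i \<in> {1..t} - {k}. (q i - 1)))"
proof -
  \<comment> \<open>List positions start at 0 while the fields are numbered from 1, so position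
    \<open>i\<close> holds \<open>F (Suc i)\<close> and the minimising index \<open>k\<close>
    becomes position \<open>k - 1\<close>, a true predecessor since \<open>k\<close> is at least
    1.\<close>
  define Rs where "Rs = map F [1..<Suc t]"
  have len: "length Rs = t"
    by (simp add: Rs_def)
  have nth: "Rs ! i = F (Suc i)" if "i < t" for i
    using that by (simp add: Rs_def nth_append del: upt_Suc)
  interpret field_list3 Rs
  proof (intro field_list3.intro field_list.intro field_list3_axioms.intro)
    show "field (Rs ! i)" if "i < length Rs" for i
      using that assms(2) by (simp add: len nth)
    show "length Rs \<ge> 3"
      using assms(1) by (simp add: len)
  qed
  have k: "1 \<le> k" "k \<le> t" "\<And>i. 1 \<le> i \<Longrightarrow> i \<le> t \<Longrightarrow> q k \<le> q i"
    using assms(5) by (auto simp: is_arg_min_linorder)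
  have qRs: "order (Rs ! i) = q (Suc i)" if "i < t" for i
    using that assms(4) by (simp add: nth)
  have "(\<Prod>i \<in> {1..t} - {k}. q i - 1) = (\<Prod>j\<in>{..<t} - {k - 1}. order (Rs ! j) - 1)"
    using k(1) by (intro prod.reindex_bij_witness[of _ Suc "\<lambda>i. i - 1"]) (auto simp: qRs)
  moreover have "independence_number (weak_zero_divisor_difference_graph (RDirProd_list Rs))
      = max t (1 + (\<Prod>j\<in>{..<t} - {k - 1}. order (Rs ! j) - 1))"
    unfolding len[symmetric]
  proof (rule independence_number_difference)
    show "finite (carrier (Rs ! i))" if "i < length Rs" for i
      using that assms(3) by (simp add: len nth)
    show "k - 1 < length Rs"
      using k by (simp add: len)
    show "order (Rs ! (k - 1)) \<le> order (Rs ! i)" if "i < length Rs" for i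
      using that k by (simp add: len qRs)
  qed
  ultimately show ?thesis
    by (simp only: Rs_def)
qed

end
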